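(* Assume: $X$ and $Y(\mathbf{x})$, for each $\mathbf{x}\in X$, are non-empty and bounded; $S=\{\mathbf{c}\in\mathbb{R}^n:\mathbf{B}\mathbf{c}\le\mathbf{b}\}$ is non-empty and compact; the leader and the follower have i.i.d. training data sets from $\mathbb{Q}^*$ and, for each $k\in K_f$, the leader either knows that the follower's $k$-th sample lies in a given box $\hat S_l^{(k)}=\{\mathbf{c}:\underline{\mathbf{b}}^{(k)}\le\mathbf{c}\le\overline{\mathbf{b}}^{(k)}\}\subseteq S$ or knows that it is a given element of $\hat{\mathbf{C}}_l$ (so the true follower's data set $\hat{\mathbf{C}}_f^*$ lies in $\hat S_l$). Let $$z_b^*:=\min_{\mathbf{x},\mathbf{y}}\Big\{\max_{\mathbb{Q}_l\in\mathcal{Q}_l}\rho_l(\mathbf{y},\mathbb{Q}_l):\ \mathbf{x}\in X,\ \mathbf{y}\in\arg\max_{\tilde{\mathbf{y}}\in Y(\mathbf{x})}\min_{\mathbb{Q}_f\in\mathcal{Q}_f(\hat{\mathbf{C}}_f^* )}\rho_f(\tilde{\mathbf{y}},\mathbb{Q}_f)\Big\}$$ be the optimal value of the true basic model $[\mathbf{DRI}^*]$, and let $$\hat z_{sp}':=\min_{\mathbf{x}\in X}\ \max_{\hat{\mathbf{C}}_f\in\hat S_l'}\ \min_{\mathbf{y}}\Big\{\max_{\mathbb{Q}_l\in\mathcal{Q}_l}\rho_l(\mathbf{y},\mathbb{Q}_l):\ \mathbf{y}\in\arg\max_{\tilde{\mathbf{y}}\in Y(\mathbf{x})}\min_{\mathbb{Q}_f\in\mathcal{Q}_f(\hat{\mathbf{C}}_f)}\rho_f(\tilde{\mathbf{y}},\mathbb{Q}_f)\Big\}$$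 be the optimal value of the discretized semi-pessimistic approximation $[\mathbf{DRI\text{-}SP}']$, where $\hat S_l'=\{\hat{\mathbf{C}}_f^{(r)}:r=1,\dots,r_l\}$ consists of $r_l$ scenarios generated (independently) from a probability distribution $\mathbb{P}$ on $\hat S_l$. Then, for any scenario-generating distribution $\mathbb{P}\in\mathcal{Q}_0(\hat S_l)$ that is fully supported on $\hat S_l$ and any $\delta'>0$, as $r_l$ tends to infinity, the inequality $$\hat z_{sp}'\ \ge\ z_b^*-\delta'$$ holds almost surely (i.e., with probability one it holds for all sufficiently large $r_l$).
   Context: $X=\{\mathbf{x}\in\{0,1\}^m:\mathbf{H}\mathbf{x}\le\mathbf{h}\}$, $Y(\mathbf{x})=\{\mathbf{y}\in\mathbb{R}^n_+:\mathbf{F}\mathbf{y}+\mathbf{L}\mathbf{x}\le\mathbf{f}\}$; $\mathcal{Q}_0(A)$ is the set of probability distributions on $A$; $\mathbb{Q}^*\in\mathcal{Q}_0(S)$ is the true distribution of $\mathbf{c}$. Leader's data: $\hat{\mathbf{C}}_l=\{\hat{\mathbf{c}}_l^{(k)}\in S:k\in K_l=\{1,\dots,k_l\}\}$ (fixed); $K_f=\{1,\dots,k_f\}$. Uncertainty set $\hat S_l=\hat S_l^{(1)}\times\dots\times\hat S_l^{(k_f)}$, where $\hat S_l^{(k)}$ is the singleton of the follower's $k$-th sample when this sample is known to be in $\hat{\mathbf{C}}_l$, and the given box otherwise. "Fully supported on $\hat S_l$" means that the support of $\mathbb{P}$ is all of $\hat S_l$. For $i\in\{l,f\}$, $\mathcal{Q}_i=\mathcal{Q}_i(\hat{\mathbf{C}}_i)=\{\mathbb{Q}\in\mathcal{Q}_0(S):W^p(\hat{\mathbb{Q}}_i,\mathbb{Q})\le\varepsilon_i\}$,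 $\hat{\mathbb{Q}}_i=\frac1{k_i}\sum_{k\in K_i}\delta(\hat{\mathbf{c}}_i^{(k)})$, $\varepsilon_i\in\mathbb{R}_+$, $W^p$ the type-1 Wasserstein distance with the $\ell_p$-norm as ground metric, $p\in\{1,\infty\}$. $\rho_l(\mathbf{y},\mathbb{Q})=\min_{t\in\mathbb{R}}\{t+\frac1{1-\alpha_l}\mathbb{E}_{\mathbb{Q}}[(\mathbf{c}^\top\mathbf{y}-t)^+]\}$, $\rho_f(\mathbf{y},\mathbb{Q})=\max_{t\in\mathbb{R}}\{t+\frac1{1-\alpha_f}\mathbb{E}_{\mathbb{Q}}[(\mathbf{c}^\top\mathbf{y}-t)^-]\}$, $\alpha_l,\alpha_f\in(0,1)$, $a^+=\max\{a,0\}$, $a^-=\min\{a,0\}$. *)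

theory Defs
  imports "HOL-Probability.Probability"
begin

text \<open>Distributions on \<open>A\<close> are Borel measures on the whole ambient space concentrated on \<open>A\<close>.\<close>

definition dists_on :: "'a::topological_space set \<Rightarrow> 'a measure set" where
  "dists_on A = {Q. prob_space Q \<and> sets Q = sets borel \<and> A \<in> sets borel \<and> emeasure Q A = 1}"

definition supp_measure :: "'a::topological_space measure \<Rightarrow> 'a set" where
  "supp_measure P = {c. \<forall>U. open U \<and> c \<in> U \<longrightarrow> emeasure P U > 0}"

definition iid_samples ::
  "'w measure \<Rightarrow> 'a::topological_space measure \<Rightarrow> ('i \<Rightarrow> 'w \<Rightarrow> 'a) \<Rightarrow> bool" where
  "iid_samples M Q \<xi> \<longleftrightarrow>
     prob_space M \<and> prob_space.indep_vars M (\<lambda>_. borel) \<xi> UNIV \<and>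
     (\<forall>i. distr M borel (\<xi> i) = Q)"

definition lp_norm :: "ereal \<Rightarrow> real ^ 'n \<Rightarrow> real" where
  "lp_norm p x =
     (if p = \<infinity> then infnorm x
      else (\<Sum>i\<in>UNIV. \<bar>x $ i\<bar> powr real_of_ereal p) powr (1 / real_of_ereal p))"

definition couplings ::
  "'a::topological_space measure \<Rightarrow> 'a measure \<Rightarrow> ('a \<times> 'a) measure set" where
  "couplings P Q =
     {\<pi>. prob_space \<pi> \<and> sets \<pi> = sets (borel \<Otimes>\<^sub>M borel) \<and>
         distr \<pi> borel fst = P \<and> distr \<pi> borel snd = Q}"

definition wasserstein1 ::
  "ereal \<Rightarrow> (real ^ 'n) measure \<Rightarrow> (real ^ 'n) measure \<Rightarrow> ennreal" where
  "wasserstein1 p P Q =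
     (INF \<pi>\<in>couplings P Q. \<integral>\<^sup>+ (c, c'). ennreal (lp_norm p (c - c')) \<partial>\<pi>)"

text \<open>A data set of \<open>CARD('k)\<close> samples is a vector indexed by \<open>'k\<close>; repeated samples
  are counted with multiplicity in its empirical distribution.\<close>

definition empirical :: "(real ^ 'n) ^ 'k \<Rightarrow> (real ^ 'n) measure" where
  "empirical C = distr (uniform_count_measure UNIV) borel (\<lambda>k. C $ k)"

definition ambiguity_set ::
  "ereal \<Rightarrow> real \<Rightarrow> (real ^ 'n) set \<Rightarrow> (real ^ 'n) ^ 'k \<Rightarrow> (real ^ 'n) measure set" where
  "ambiguity_set p \<epsilon> S C = {Q \<in> dists_on S. wasserstein1 p (empirical C) Q \<le> ennreal \<epsilon>}"

definition rho_l :: "real \<Rightarrow> real ^ 'n \<Rightarrow> (real ^ 'n) measure \<Rightarrow> real" where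
  "rho_l \<alpha> y Q = (INF t. t + 1 / (1 - \<alpha>) * (\<integral>c. max (c \<bullet> y - t) 0 \<partial>Q))"

definition rho_f :: "real \<Rightarrow> real ^ 'n \<Rightarrow> (real ^ 'n) measure \<Rightarrow> real" where
  "rho_f \<alpha> y Q = (SUP t. t + 1 / (1 - \<alpha>) * (\<integral>c. min (c \<bullet> y - t) 0 \<partial>Q))"

text \<open>Optimal values are extended reals, so that no boundedness or non-emptiness is
  presupposed by the infima and suprema.\<close>

definition leader_objective ::
  "ereal \<Rightarrow> (real ^ 'n) set \<Rightarrow> real \<Rightarrow> real \<Rightarrow> (real ^ 'n) ^ 'kl \<Rightarrow> real ^ 'n \<Rightarrow> ereal" where
  "leader_objective p S \<alpha>\<^sub>l \<epsilon>\<^sub>l C\<^sub>l y =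
     (SUP Q\<in>ambiguity_set p \<epsilon>\<^sub>l S C\<^sub>l. ereal (rho_l \<alpha>\<^sub>l y Q))"

definition follower_objective ::
  "ereal \<Rightarrow> (real ^ 'n) set \<Rightarrow> real \<Rightarrow> real \<Rightarrow> (real ^ 'n) ^ 'kf \<Rightarrow> real ^ 'n \<Rightarrow> ereal" where
  "follower_objective p S \<alpha>\<^sub>f \<epsilon>\<^sub>f C\<^sub>f y =
     (INF Q\<in>ambiguity_set p \<epsilon>\<^sub>f S C\<^sub>f. ereal (rho_f \<alpha>\<^sub>f y Q))"

definition follower_argmax ::
  "ereal \<Rightarrow> (real ^ 'n) set \<Rightarrow> real \<Rightarrow> real \<Rightarrow> (real ^ 'n) ^ 'kf \<Rightarrow> (real ^ 'n) set \<Rightarrow> (real ^ 'n) set"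
where
  "follower_argmax p S \<alpha>\<^sub>f \<epsilon>\<^sub>f C\<^sub>f Yx =
     {y. is_arg_max (follower_objective p S \<alpha>\<^sub>f \<epsilon>\<^sub>f C\<^sub>f) (\<lambda>y. y \<in> Yx) y}"

definition basic_value ::
  "(real ^ 'm) set \<Rightarrow> (real ^ 'm \<Rightarrow> (real ^ 'n) set) \<Rightarrow> ereal \<Rightarrow> (real ^ 'n) set \<Rightarrow>
   real \<Rightarrow> real \<Rightarrow> (real ^ 'n) ^ 'kl \<Rightarrow> real \<Rightarrow> real \<Rightarrow> (real ^ 'n) ^ 'kf \<Rightarrow> ereal" where
  "basic_value X Y p S \<alpha>\<^sub>l \<epsilon>\<^sub>l C\<^sub>l \<alpha>\<^sub>f \<epsilon>\<^sub>f C\<^sub>f =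
     (INF (x, y)\<in>{(x, y). x \<in> X \<and> y \<in> follower_argmax p S \<alpha>\<^sub>f \<epsilon>\<^sub>f C\<^sub>f (Y x)}.
        leader_objective p S \<alpha>\<^sub>l \<epsilon>\<^sub>l C\<^sub>l y)"

definition semi_pessimistic_value ::
  "(real ^ 'm) set \<Rightarrow> (real ^ 'm \<Rightarrow> (real ^ 'n) set) \<Rightarrow> ereal \<Rightarrow> (real ^ 'n) set \<Rightarrow>
   real \<Rightarrow> real \<Rightarrow> (real ^ 'n) ^ 'kl \<Rightarrow> real \<Rightarrow> real \<Rightarrow> ((real ^ 'n) ^ 'kf) set \<Rightarrow> ereal" where
  "semi_pessimistic_value X Y p S \<alpha>\<^sub>l \<epsilon>\<^sub>l C\<^sub>l \<alpha>\<^sub>f \<epsilon>\<^sub>f U =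
     (INF x\<in>X. SUP C\<^sub>f\<in>U. INF y\<in>follower_argmax p S \<alpha>\<^sub>f \<epsilon>\<^sub>f C\<^sub>f (Y x).
        leader_objective p S \<alpha>\<^sub>l \<epsilon>\<^sub>l C\<^sub>l y)"

text \<open>\<open>known k = Some j\<close> means that the follower's \<open>k\<close>-th sample is known to be the leader's
  \<open>j\<close>-th sample; \<open>known k = None\<close> means that it is only known to lie in the \<open>k\<close>-th box.
  The order on vectors is componentwise.\<close>

definition data_uncertainty_set ::
  "('kf \<Rightarrow> 'kl option) \<Rightarrow> (real ^ 'n) ^ 'kf \<Rightarrow> (real ^ 'n) ^ 'kf \<Rightarrow> (real ^ 'n) ^ 'kl \<Rightarrow>
   ((real ^ 'n) ^ 'kf) set" where
  "data_uncertainty_set known lo hi C\<^sub>l =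
     {C. \<forall>k. C $ k \<in> (case known k of Some j \<Rightarrow> {C\<^sub>l $ j} | None \<Rightarrow> {lo $ k .. hi $ k})}"

end

theory Submission
  imports Defs
begin

text \<open>
  For each of the finitely many \<open>x \<in> X\<close> let \<open>V x C\<close> be the leader's optimistic value when the follower
  holds the data set \<open>C\<close>; the true optimal value is \<open>min\<^sub>x V x C\<^sub>f_star\<close>. It suffices that every
  \<open>V x\<close> is lower semicontinuous at \<open>C\<^sub>f_star\<close>: then \<open>V x C \<ge> V x C\<^sub>f_star - \<delta>\<close> for all \<open>x\<close> and all \<open>C\<close>
  in a neighbourhood of \<open>C\<^sub>f_star\<close>, which has positive mass because \<open>P\<close> is fully supported, and hence
  almost surely contains a scenario. Lower semicontinuity follows as in Berge's maximum theorem once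
  the follower's objective is Lipschitz in the data and the decision. Given \<open>Q\<close> in the
  Wasserstein ball around the empirical distribution of \<open>C\<close>, moving its mass slightly towards the
  samples of \<open>C'\<close>, inside the convex set \<open>S\<close>, yields a nearby distribution in the ball around the
  empirical distribution of \<open>C'\<close>.
\<close>

section \<open>The two ground norms\<close>

lemma lp_norm_1: "lp_norm 1 x = (\<Sum>i\<in>UNIV. \<bar>x $ i\<bar>)"
  by (simp add: lp_norm_def sum_nonneg)

lemma lp_norm_infinity: "lp_norm \<infinity> x = infnorm x"
  by (simp add: lp_norm_def)

context
  fixes p :: ereal
  assumes p: "p \<in> {1, \<infinity>}"
begin

lemma lp_norm_nonneg: "0 \<le> lp_norm p x"
  using p by (auto simp: lp_norm_1 lp_norm_infinity infnorm_pos_le sum_nonneg)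

lemma lp_norm_triangle: "lp_norm p (x + y) \<le> lp_norm p x + lp_norm p y"
  using p by (auto simp: lp_norm_1 lp_norm_infinity infnorm_triangle sum.distrib[symmetric]
      intro!: sum_mono abs_triangle_ineq)

lemma lp_norm_scaleR: "lp_norm p (a *\<^sub>R x) = \<bar>a\<bar> * lp_norm p x"
  using p by (auto simp: lp_norm_1 lp_norm_infinity infnorm_mul sum_distrib_left abs_mult)

text \<open>Together with \<open>norm_le_lp_norm\<close> this trades transport costs for Euclidean
  distances. The crude factor \<open>CARD('n)\<close> fits both values of \<open>p\<close> and both
  directions.\<close>

lemma lp_norm_le_norm: "lp_norm p (x :: real ^ 'n) \<le> real CARD('n) * norm x"
proof -
  have "infnorm x \<le> real CARD('n) * norm x"
    using infnorm_le_norm[of x] mult_right_mono[of 1 "real CARD('n)" "norm x"] by simp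
  moreover have "(\<Sum>i\<in>UNIV. \<bar>x $ i\<bar>) \<le> real CARD('n) * norm x"
    by (rule sum_bounded_above) (rule component_le_norm_cart)
  ultimately show ?thesis
    using p by (auto simp: lp_norm_1 lp_norm_infinity)
qed

lemma norm_le_lp_norm: "norm (x :: real ^ 'n) \<le> real CARD('n) * lp_norm p x"
proof -
  have *: "(\<Sum>i\<in>UNIV. \<bar>x $ i\<bar>) \<le> real CARD('n) * a" if "\<And>i. \<bar>x $ i\<bar> \<le> a" for a
    by (rule sum_bounded_above) (rule that)
  have "norm x \<le> real CARD('n) * infnorm x"
    using norm_le_l1_cart[of x] *[OF component_le_infnorm_cart] by simp
  moreover have "(\<Sum>i\<in>UNIV. \<bar>x $ i\<bar>) \<le> real CARD('n) * (\<Sum>i\<in>UNIV. \<bar>x $ i\<bar>)"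
    by (rule *) (rule member_le_sum, auto)
  ultimately show ?thesis
    using p norm_le_l1_cart[of x] by (auto simp: lp_norm_1 lp_norm_infinity)
qed

lemma measurable_lp_norm [measurable]: "lp_norm p \<in> borel_measurable borel"
proof -
  have "continuous_on UNIV (lp_norm p :: real ^ 'n \<Rightarrow> real)"
    using p by (auto simp: lp_norm_1[abs_def] lp_norm_infinity[abs_def] intro!: continuous_intros)
  then show ?thesis
    by (rule borel_measurable_continuous_onI)
qed

end

section \<open>Couplings with an empirical distribution\<close>

text \<open>Passing from \<open>C\<close> to \<open>C'\<close> relocates each sample separately, but
  a coupling of \<open>empirical C\<close> records only sample values, and equal values may have
  different destinations. Recording the index makes the relocation well defined and keeps the index
  marginal uniform.\<close>

lemma lift_coupling_to_index:
  fixes C :: "(real ^ 'n) ^ 'k"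
  assumes "\<pi> \<in> couplings (empirical C) Q"
  obtains \<rho> :: "('k \<times> (real ^ 'n)) measure"
  where "prob_space \<rho>" "sets \<rho> = sets (count_space UNIV \<Otimes>\<^sub>M borel)"
    "distr \<rho> (count_space UNIV) fst = uniform_count_measure UNIV"
    "distr \<rho> borel snd = Q"
    "\<And>g. g \<in> borel_measurable (borel \<Otimes>\<^sub>M borel) \<Longrightarrow>
       (\<integral>\<^sup>+ (k, c). g (C $ k, c) \<partial>\<rho>) = (\<integral>\<^sup>+ z. g z \<partial>\<pi>)"
proof -
  txt \<open>Samples may coincide: the mass of \<open>\<pi>\<close> over a repeated value is split equally among its indices.\<close>
  define K where "K = (\<lambda>a. {k. C $ k = a})"
  define w where "w = (\<lambda>(z :: (real ^ 'n) \<times> (real ^ 'n), k).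
    indicator (K (fst z)) k * ennreal (1 / real (card (K (fst z)))))"
  define \<rho> where "\<rho> = distr (density (\<pi> \<Otimes>\<^sub>M count_space UNIV) w) (count_space UNIV \<Otimes>\<^sub>M borel)
    (\<lambda>(z, k). (k, snd z))"
  have \<pi>: "prob_space \<pi>" "sets \<pi> = sets (borel \<Otimes>\<^sub>M borel)"
    "distr \<pi> borel fst = empirical C" "distr \<pi> borel snd = Q"
    using assms by (auto simp: couplings_def)
  interpret \<pi>: prob_space \<pi> by fact
  note [measurable_cong] = \<pi>(2)
  interpret count: sigma_finite_measure "count_space (UNIV :: 'k set)"
    by (rule sigma_finite_measure_count_space_finite) simp
  \<comment> \<open>In this form the weight depends on \<open>z\<close> only through the finitely
    many tests \<open>fst z = C $ k\<close>, which makes it visibly measurable.\<close>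
  have w_eq: "w = (\<lambda>(z, k). if fst z = C $ k then ennreal (1 / real (card (K (C $ k)))) else 0)"
    by (auto simp: w_def K_def fun_eq_iff)
  have [measurable]: "w \<in> borel_measurable (\<pi> \<Otimes>\<^sub>M count_space UNIV)"
    unfolding w_eq by measurable
  have int_\<rho>: "(\<integral>\<^sup>+ x. g x \<partial>\<rho>) = (\<integral>\<^sup>+ z. (\<Sum>k\<in>UNIV. w (z, k) * g (k, snd z)) \<partial>\<pi>)"
    if [measurable]: "g \<in> borel_measurable (count_space UNIV \<Otimes>\<^sub>M borel)" for g
  proof -
    have "(\<integral>\<^sup>+ x. g x \<partial>\<rho>) = (\<integral>\<^sup>+ x. w x * g (snd x, snd (fst x)) \<partial>(\<pi> \<Otimes>\<^sub>M count_space UNIV))"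
      unfolding \<rho>_def by (simp add: nn_integral_distr nn_integral_density case_prod_unfold)
    also have "\<dots> = (\<integral>\<^sup>+ z. (\<Sum>k\<in>UNIV. w (z, k) * g (k, snd z)) \<partial>\<pi>)"
      by (subst count.nn_integral_fst[symmetric]) (simp_all add: nn_integral_count_space_finite)
    finally show ?thesis .
  qed
  \<comment> \<open>Off the sample values all weights vanish, but \<open>\<pi>\<close> gives such
    points no mass because its first marginal is \<open>empirical C\<close>.\<close>
  have [measurable]: "range (($) C) \<in> sets borel"
    by (intro borel_closed finite_imp_closed) simp
  have "AE a in empirical C. a \<in> range (($) C)"
    unfolding empirical_def by (subst AE_distr_iff) simp_all
  then have range: "AE z in \<pi>. fst z \<in> range (($) C)"
    unfolding \<pi>(3)[symmetric] by (subst (asm) AE_distr_iff) simp_all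
  have w_sum: "(\<Sum>k\<in>UNIV. w (z, k)) = 1" if "fst z \<in> range (($) C)" for z
  proof -
    have "K (fst z) \<noteq> {}" using that by (auto simp: K_def)
    moreover have "(\<Sum>k\<in>UNIV. w (z, k)) = (\<Sum>k\<in>K (fst z). ennreal (1 / real (card (K (fst z)))))"
      by (intro sum.mono_neutral_cong_right) (auto simp: w_def)
    ultimately show ?thesis
      by (simp add: ennreal_of_nat_eq_real_of_nat ennreal_mult[symmetric] card_gt_0_iff)
  qed
  have int_C: "(\<integral>\<^sup>+ (k, c). g (C $ k, c) \<partial>\<rho>) = (\<integral>\<^sup>+ z. g z \<partial>\<pi>)"
    if [measurable]: "g \<in> borel_measurable (borel \<Otimes>\<^sub>M borel)" for g
  proof -
    have "(\<integral>\<^sup>+ (k, c). g (C $ k, c) \<partial>\<rho>) = (\<integral>\<^sup>+ z. (\<Sum>k\<in>UNIV. w (z, k) * g (C $ k, snd z)) \<partial>\<pi>)"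
      by (subst int_\<rho>) (auto simp: case_prod_unfold)
    also have "\<dots> = (\<integral>\<^sup>+ z. g z * (\<Sum>k\<in>UNIV. w (z, k)) \<partial>\<pi>)"
      by (intro nn_integral_cong)
        (auto simp: sum_distrib_left w_eq mult.commute intro!: sum.cong)
    also have "\<dots> = (\<integral>\<^sup>+ z. g z \<partial>\<pi>)"
      by (intro nn_integral_cong_AE, use range in eventually_elim) (simp add: w_sum)
    finally show ?thesis .
  qed
  have [measurable_cong]: "sets \<rho> = sets (count_space UNIV \<Otimes>\<^sub>M borel)"
    by (simp add: \<rho>_def)
  have "emeasure \<rho> (space \<rho>) = (\<integral>\<^sup>+ z. 1 \<partial>\<pi>)"
    using int_C[of "\<lambda>_. 1"] by (simp add: case_prod_unfold)
  then have prob: "prob_space \<rho>"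
    by (intro prob_spaceI) (simp add: \<pi>.emeasure_space_1)
  have snd: "distr \<rho> borel snd = Q"
  proof (rule measure_eqI)
    show "sets (distr \<rho> borel snd) = sets Q" using \<pi>(4) by auto
    fix A assume "A \<in> sets (distr \<rho> borel snd)"
    then have [measurable]: "A \<in> sets borel" by simp
    have "emeasure (distr \<rho> borel snd) A = (\<integral>\<^sup>+ x. indicator A (snd x) \<partial>\<rho>)"
      by (simp add: nn_integral_distr flip: nn_integral_indicator)
    also have "\<dots> = (\<integral>\<^sup>+ z. indicator A (snd z) \<partial>\<pi>)"
      using int_C[of "\<lambda>z. indicator A (snd z)"] by (simp add: case_prod_unfold)
    also have "\<dots> = emeasure Q A"
      unfolding \<pi>(4)[symmetric]
      by (simp add: nn_integral_distr flip: nn_integral_indicator)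
    finally show "emeasure (distr \<rho> borel snd) A = emeasure Q A" .
  qed
  have fst: "distr \<rho> (count_space UNIV) fst = uniform_count_measure UNIV"
  proof (rule measure_eqI_finite)
    show "sets (distr \<rho> (count_space UNIV) fst) = Pow UNIV"
      "sets (uniform_count_measure UNIV) = Pow (UNIV :: 'k set)" "finite (UNIV :: 'k set)"
      by (auto simp: sets_uniform_count_measure_count_space)
    fix k :: 'k
    have pos: "card (K (C $ k)) > 0"
      by (auto simp: K_def card_gt_0_iff)
    \<comment> \<open>The atom of \<open>empirical C\<close> at \<open>C $ k\<close> has mass
      \<open>card (K (C $ k)) / CARD('k)\<close>; the equal split leaves exactly
      \<open>1 / CARD('k)\<close> for each index.\<close>
    have "emeasure (distr \<rho> (count_space UNIV) fst) {k} = (\<integral>\<^sup>+ x. indicator {k} (fst x) \<partial>\<rho>)"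
      by (simp add: nn_integral_distr flip: nn_integral_indicator)
    also have "\<dots> = (\<integral>\<^sup>+ z. (\<Sum>j\<in>UNIV. w (z, j) * indicator {k} j) \<partial>\<pi>)"
      by (subst int_\<rho>) auto
    also have "\<dots> = (\<integral>\<^sup>+ z. ennreal (1 / real (card (K (C $ k)))) * indicator {C $ k} (fst z) \<partial>\<pi>)"
      by (intro nn_integral_cong) (auto simp: w_eq sum.remove[of UNIV k] indicator_def)
    also have "\<dots> = ennreal (1 / real (card (K (C $ k)))) * (\<integral>\<^sup>+ a. indicator {C $ k} a \<partial>empirical C)"
      unfolding \<pi>(3)[symmetric]
      by (simp add: nn_integral_cmult nn_integral_distr del: nn_integral_indicator nn_integral_indicator_singleton)
    also have "(\<integral>\<^sup>+ a. indicator {C $ k} a \<partial>empirical C) = emeasure (uniform_count_measure UNIV) (K (C $ k))"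
      by (simp add: empirical_def emeasure_distr K_def vimage_def)
    also have "\<dots> = ennreal (real (card (K (C $ k))) / real CARD('k))"
      by (simp add: emeasure_uniform_count_measure)
    also have "ennreal (1 / real (card (K (C $ k)))) * \<dots> = ennreal (1 / real CARD('k))"
      using pos by (auto simp: ennreal_mult[symmetric])
    also have "\<dots> = emeasure (uniform_count_measure UNIV) {k}"
      by (simp add: emeasure_uniform_count_measure)
    finally show "emeasure (distr \<rho> (count_space UNIV) fst) {k} = emeasure (uniform_count_measure UNIV) {k}" .
  qed
  show thesis
    by (rule that[of \<rho>]) (use prob fst snd int_C in \<open>auto simp: \<rho>_def\<close>)
qed

section \<open>Stability of the risk measures\<close>

text \<open>Both distributions are images of one \<open>\<rho>\<close>, so outcomes can be compared
  pointwise. Since \<open>min (a - t) 0\<close> is 1-Lipschitz in \<open>a\<close>, the inner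
  expectation grows by at most \<open>D\<close>, uniformly in \<open>t\<close>, and the supremum
  inherits this with the factor \<open>1 / (1 - \<alpha>)\<close>.\<close>

lemma rho_f_distr_le:
  fixes u w :: "'z \<Rightarrow> real ^ 'n"
  assumes "prob_space \<rho>" and \<alpha>: "\<alpha> \<in> {0<..<1}"
    and [measurable]: "u \<in> borel_measurable \<rho>" "w \<in> borel_measurable \<rho>"
    and int: "integrable \<rho> (\<lambda>z. u z \<bullet> y)" "integrable \<rho> (\<lambda>z. w z \<bullet> y')"
    and D: "(\<integral>z. \<bar>w z \<bullet> y' - u z \<bullet> y\<bar> \<partial>\<rho>) \<le> D"
  shows "rho_f \<alpha> y' (distr \<rho> borel w) \<le> rho_f \<alpha> y (distr \<rho> borel u) + D / (1 - \<alpha>)"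
proof -
  interpret prob_space \<rho> by fact
  define \<beta> where "\<beta> = 1 / (1 - \<alpha>)"
  have \<beta>: "\<beta> \<ge> 1" using \<alpha> by (simp add: \<beta>_def)
  define \<phi> where "\<phi> = (\<lambda>v t. t + \<beta> * (\<integral>z. min (v z - t) 0 \<partial>\<rho>))"
  have rho: "rho_f \<alpha> x (distr \<rho> borel v) = (SUP t. \<phi> (\<lambda>z. v z \<bullet> x) t)"
    if [measurable]: "v \<in> borel_measurable \<rho>" for v and x :: "real ^ 'n"
    by (simp add: rho_f_def \<phi>_def \<beta>_def integral_distr)
  have int': "integrable \<rho> (\<lambda>z. min (v z - t) 0)" if "integrable \<rho> v" for v :: "'z \<Rightarrow> real" and t
    using that by (intro integrable_min) auto
  \<comment> \<open>The real supremum is only meaningful when bounded. The integrand is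
    non-positive, so \<open>\<beta> \<ge> 1\<close> may be lowered to 1; bounding the integrand by
    \<open>v z - t\<close> then cancels \<open>t\<close>.\<close>
  have bdd: "bdd_above (range (\<phi> v))" if v: "integrable \<rho> v" for v
  proof (rule bdd_aboveI2)
    fix t
    have "(\<integral>z. min (v z - t) 0 \<partial>\<rho>) \<le> 0"
      using integral_nonneg_AE[of "\<lambda>z. - min (v z - t) 0" \<rho>] by simp
    then have "\<phi> v t \<le> t + (\<integral>z. min (v z - t) 0 \<partial>\<rho>)"
      using mult_right_mono_neg[OF \<beta>] by (simp add: \<phi>_def)
    also have "(\<integral>z. min (v z - t) 0 \<partial>\<rho>) \<le> (\<integral>z. v z - t \<partial>\<rho>)"
      by (intro integral_mono int' v) (use v in auto)
    also have "t + (\<integral>z. v z - t \<partial>\<rho>) = expectation v"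
      using v by (simp add: prob_space)
    finally show "\<phi> v t \<le> expectation v" by simp
  qed
  have "(SUP t. \<phi> (\<lambda>z. w z \<bullet> y') t) \<le> (SUP t. \<phi> (\<lambda>z. u z \<bullet> y) t) + \<beta> * D"
  proof (rule cSUP_least)
    fix t
    have "(\<integral>z. min (w z \<bullet> y' - t) 0 \<partial>\<rho>)
        \<le> (\<integral>z. min (u z \<bullet> y - t) 0 + \<bar>w z \<bullet> y' - u z \<bullet> y\<bar> \<partial>\<rho>)"
      by (intro integral_mono int' Bochner_Integration.integrable_add integrable_abs
          Bochner_Integration.integrable_diff int) auto
    also have "\<dots> = (\<integral>z. min (u z \<bullet> y - t) 0 \<partial>\<rho>) + (\<integral>z. \<bar>w z \<bullet> y' - u z \<bullet> y\<bar> \<partial>\<rho>)"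
      by (intro Bochner_Integration.integral_add int' int integrable_abs
          Bochner_Integration.integrable_diff)
    finally have "(\<integral>z. min (w z \<bullet> y' - t) 0 \<partial>\<rho>) \<le> (\<integral>z. min (u z \<bullet> y - t) 0 \<partial>\<rho>) + D"
      using D by simp
    then have "\<beta> * (\<integral>z. min (w z \<bullet> y' - t) 0 \<partial>\<rho>) \<le> \<beta> * ((\<integral>z. min (u z \<bullet> y - t) 0 \<partial>\<rho>) + D)"
      using \<beta> by (intro mult_left_mono) auto
    then have "\<phi> (\<lambda>z. w z \<bullet> y') t \<le> \<phi> (\<lambda>z. u z \<bullet> y) t + \<beta> * D"
      by (simp add: \<phi>_def algebra_simps)
    also have "\<phi> (\<lambda>z. u z \<bullet> y) t \<le> (SUP t. \<phi> (\<lambda>z. u z \<bullet> y) t)"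
      by (intro cSUP_upper bdd int) simp
    finally show "\<phi> (\<lambda>z. w z \<bullet> y') t \<le> (SUP t. \<phi> (\<lambda>z. u z \<bullet> y) t) + \<beta> * D" by simp
  qed simp
  then show ?thesis
    by (simp add: rho \<beta>_def)
qed

text \<open>Changing the sign of \<open>y\<close> and \<open>t\<close> mirrors the leader's risk
  into the follower's, so one stability estimate serves both.\<close>

lemma rho_l_eq_rho_f: "rho_l \<alpha> y Q = - rho_f \<alpha> (- y) Q"
proof -
  define \<phi> where "\<phi> = (\<lambda>t. t + 1 / (1 - \<alpha>) * (\<integral>c. min (c \<bullet> (- y) - t) 0 \<partial>Q))"
  have "t + 1 / (1 - \<alpha>) * (\<integral>c. max (c \<bullet> y - t) 0 \<partial>Q) = - \<phi> (- t)" for t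
  proof -
    have "(\<lambda>c. max (c \<bullet> y - t) 0) = (\<lambda>c. - min (c \<bullet> (- y) - (- t)) 0)"
      by (auto simp: fun_eq_iff)
    then show ?thesis by (simp add: \<phi>_def)
  qed
  then have "rho_l \<alpha> y Q = Inf (range (\<lambda>t. - \<phi> (- t)))"
    by (simp add: rho_l_def)
  \<comment> \<open>On the reals \<open>Inf\<close> is by definition the negated \<open>Sup\<close>
    of the negated set, so the equation holds unconditionally.\<close>
  also have "\<dots> = - Sup (range (\<lambda>t. \<phi> (- t)))"
    by (simp add: Inf_real_def image_image)
  also have "range (\<lambda>t. \<phi> (- t)) = range \<phi>"
    using surj_uminus by (metis image_image)
  finally show ?thesis
    by (simp add: rho_f_def \<phi>_def)
qed

lemma AE_dists_on:
  assumes "Q \<in> dists_on S"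
  shows "AE c in Q. c \<in> S"
proof -
  interpret prob_space Q using assms by (simp add: dists_on_def)
  show ?thesis
    using assms by (intro AE_prob_1) (simp add: dists_on_def measure_def)
qed

lemma integrable_inner_bounded:
  fixes u :: "'z \<Rightarrow> real ^ 'n"
  assumes "prob_space \<rho>" "bounded S" and [measurable]: "u \<in> borel_measurable \<rho>"
    and "AE z in \<rho>. u z \<in> S"
  shows "integrable \<rho> (\<lambda>z. u z \<bullet> y)"
proof -
  interpret prob_space \<rho> by fact
  obtain R where R: "\<And>c. c \<in> S \<Longrightarrow> norm c \<le> R"
    using assms(2) by (auto simp: bounded_iff)
  have "AE z in \<rho>. norm (u z \<bullet> y) \<le> R * norm y"
    using assms(4)
  proof eventually_elim
    case (elim z)
    have "norm (u z \<bullet> y) \<le> norm (u z) * norm y"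
      by (simp add: Cauchy_Schwarz_ineq2)
    also have "\<dots> \<le> R * norm y"
      using R[OF elim] by (intro mult_right_mono) auto
    finally show ?case .
  qed
  then show ?thesis
    by (intro integrable_const_bound) simp_all
qed

text \<open>The change splits as \<open>(w z - u z) \<bullet> y + w z \<bullet> (y' - y)\<close>:
  the first part is paid by the transport cost \<open>d\<close>, the second by the bound
  \<open>R\<close> on \<open>S\<close>.\<close>

lemma rho_f_distr_perturb:
  fixes u w :: "'z \<Rightarrow> real ^ 'n"
  assumes "prob_space \<rho>" and \<alpha>: "\<alpha> \<in> {0<..<1}"
    and [measurable]: "u \<in> borel_measurable \<rho>" "w \<in> borel_measurable \<rho>"
    and S: "AE z in \<rho>. u z \<in> S" "AE z in \<rho>. w z \<in> S"
    and R: "\<And>c. c \<in> S \<Longrightarrow> norm c \<le> R"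
    and d: "(\<integral>\<^sup>+ z. ennreal (norm (w z - u z)) \<partial>\<rho>) \<le> ennreal d" "d \<ge> 0"
  shows "rho_f \<alpha> y' (distr \<rho> borel w)
    \<le> rho_f \<alpha> y (distr \<rho> borel u) + (d * norm y + R * norm (y' - y)) / (1 - \<alpha>)"
proof (rule rho_f_distr_le[OF assms(1) \<alpha>])
  interpret prob_space \<rho> by fact
  have S': "bounded S" using R by (auto simp: bounded_iff)
  show int: "integrable \<rho> (\<lambda>z. u z \<bullet> y)" "integrable \<rho> (\<lambda>z. w z \<bullet> y')"
    by (rule integrable_inner_bounded[OF assms(1) S']; use S in simp)+
  have nint: "integrable \<rho> (\<lambda>z. norm (w z - u z))"
    by (rule integrableI_bounded) (use d in \<open>auto simp: le_less_trans\<close>)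
  then have "ennreal (\<integral>z. norm (w z - u z) \<partial>\<rho>) \<le> ennreal d"
    using d by (subst nn_integral_eq_integral[symmetric]) auto
  then have nd: "(\<integral>z. norm (w z - u z) \<partial>\<rho>) \<le> d"
    using d(2) by simp
  have "(\<integral>z. \<bar>w z \<bullet> y' - u z \<bullet> y\<bar> \<partial>\<rho>) \<le> (\<integral>z. norm (w z - u z) * norm y + R * norm (y' - y) \<partial>\<rho>)"
  proof (rule integral_mono_AE)
    show "AE z in \<rho>. \<bar>w z \<bullet> y' - u z \<bullet> y\<bar> \<le> norm (w z - u z) * norm y + R * norm (y' - y)"
      using S(2)
    proof eventually_elim
      case (elim z)
      have "\<bar>w z \<bullet> y' - u z \<bullet> y\<bar> = \<bar>(w z - u z) \<bullet> y + w z \<bullet> (y' - y)\<bar>"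
        by (simp add: inner_diff_left inner_diff_right)
      also have "\<dots> \<le> norm (w z - u z) * norm y + norm (w z) * norm (y' - y)"
        by (intro order_trans[OF abs_triangle_ineq] add_mono Cauchy_Schwarz_ineq2)
      also have "\<dots> \<le> norm (w z - u z) * norm y + R * norm (y' - y)"
        using R[OF elim] by (intro add_left_mono mult_right_mono) auto
      finally show ?case .
    qed
  qed (use int nint in simp_all)
  also have "\<dots> = (\<integral>z. norm (w z - u z) \<partial>\<rho>) * norm y + R * norm (y' - y)"
    using nint by (simp add: prob_space)
  also have "\<dots> \<le> d * norm y + R * norm (y' - y)"
    using nd by (intro add_right_mono mult_right_mono) auto
  finally show "(\<integral>z. \<bar>w z \<bullet> y' - u z \<bullet> y\<bar> \<partial>\<rho>) \<le> d * norm y + R * norm (y' - y)" .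
qed measurable

section \<open>Perturbing the data and the decision\<close>

text \<open>A coupling for \<open>C\<close>, reused for \<open>C'\<close>, may exceed the budget
  \<open>\<epsilon>\<close> by \<open>2 * d\<close>: one \<open>d\<close> because the infimum in
  \<open>wasserstein1\<close> is only approached, the other because each sample moves by at most
  \<open>d\<close>. Shrinking all displacements removes this excess, at a transport cost no larger
  than the excess.\<close>

lemma ambiguity_set_perturb:
  fixes C C' :: "(real ^ 'n) ^ 'k"
  assumes p: "p \<in> {1, \<infinity>}" and \<epsilon>: "\<epsilon> \<ge> 0" and S: "convex S" and d: "d > 0"
    and close: "\<And>k. lp_norm p (C' $ k - C $ k) \<le> d" and C': "\<And>k. C' $ k \<in> S"
    and Q: "Q \<in> ambiguity_set p \<epsilon> S C"
  obtains Q' \<pi> where "Q' \<in> ambiguity_set p \<epsilon> S C'" "\<pi> \<in> couplings Q Q'"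
    "(\<integral>\<^sup>+ (c, c'). ennreal (lp_norm p (c' - c)) \<partial>\<pi>) \<le> ennreal (2 * d)"
proof -
  note [measurable] = measurable_lp_norm[OF p]
  note N = lp_norm_nonneg[OF p]
  have Q_dist: "Q \<in> dists_on S" and "wasserstein1 p (empirical C) Q \<le> ennreal \<epsilon>"
    using Q by (auto simp: ambiguity_set_def)
  note this(2)
  also have "ennreal \<epsilon> < ennreal (\<epsilon> + d)"
    using \<epsilon> d by (simp add: ennreal_less_iff)
  finally have "wasserstein1 p (empirical C) Q < ennreal (\<epsilon> + d)" .
  then obtain \<pi> where \<pi>: "\<pi> \<in> couplings (empirical C) Q"
    "(\<integral>\<^sup>+ (c, c'). ennreal (lp_norm p (c - c')) \<partial>\<pi>) < ennreal (\<epsilon> + d)"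
    by (auto simp: wasserstein1_def Inf_less_iff)
  obtain \<rho> :: "('k \<times> (real ^ 'n)) measure" where \<rho>: "prob_space \<rho>"
    "sets \<rho> = sets (count_space UNIV \<Otimes>\<^sub>M borel)"
    "distr \<rho> (count_space UNIV) fst = uniform_count_measure UNIV"
    "distr \<rho> borel snd = Q"
    "\<And>g. g \<in> borel_measurable (borel \<Otimes>\<^sub>M borel) \<Longrightarrow>
       (\<integral>\<^sup>+ (k, c). g (C $ k, c) \<partial>\<rho>) = (\<integral>\<^sup>+ z. g z \<partial>\<pi>)"
    using lift_coupling_to_index[OF \<pi>(1)] by blast
  interpret prob_space \<rho> by fact
  note [measurable_cong] = \<rho>(2)
  have cost_C: "(\<integral>\<^sup>+ z. ennreal (lp_norm p (C $ fst z - snd z)) \<partial>\<rho>) \<le> ennreal (\<epsilon> + d)"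
    using \<rho>(5)[of "\<lambda>(c, c'). ennreal (lp_norm p (c - c'))"] \<pi>(2)
    by (simp add: case_prod_unfold)
  have "lp_norm p (C' $ fst z - snd z) \<le> lp_norm p (C $ fst z - snd z) + d" for z
    using lp_norm_triangle[OF p, of "C' $ fst z - C $ fst z" "C $ fst z - snd z"] close[of "fst z"]
    by simp
  then have "(\<integral>\<^sup>+ z. ennreal (lp_norm p (C' $ fst z - snd z)) \<partial>\<rho>)
      \<le> (\<integral>\<^sup>+ z. ennreal (lp_norm p (C $ fst z - snd z)) + ennreal d \<partial>\<rho>)"
    using d by (intro nn_integral_mono) (simp add: N ennreal_plus[symmetric] del: ennreal_plus)
  also have "\<dots> = (\<integral>\<^sup>+ z. ennreal (lp_norm p (C $ fst z - snd z)) \<partial>\<rho>) + ennreal d"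
    by (subst nn_integral_add) (auto simp: emeasure_space_1)
  also have "\<dots> \<le> ennreal (\<epsilon> + d) + ennreal d"
    by (intro add_right_mono cost_C)
  also have "\<dots> = ennreal (\<epsilon> + 2 * d)"
    using \<epsilon> d by (simp add: ennreal_plus[symmetric] del: ennreal_plus)
  finally have cost: "(\<integral>\<^sup>+ z. ennreal (lp_norm p (C' $ fst z - snd z)) \<partial>\<rho>) \<le> ennreal (\<epsilon> + 2 * d)" .
  have scaled: "(\<integral>\<^sup>+ z. ennreal (a * lp_norm p (C' $ fst z - snd z)) \<partial>\<rho>) \<le> ennreal (a * (\<epsilon> + 2 * d))"
    if "a \<ge> 0" for a
  proof -
    have "(\<integral>\<^sup>+ z. ennreal (a * lp_norm p (C' $ fst z - snd z)) \<partial>\<rho>)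
        = ennreal a * (\<integral>\<^sup>+ z. ennreal (lp_norm p (C' $ fst z - snd z)) \<partial>\<rho>)"
      by (subst nn_integral_cmult[symmetric]) (simp_all add: ennreal_mult N that)
    also have "\<dots> \<le> ennreal a * ennreal (\<epsilon> + 2 * d)"
      using cost by (rule mult_left_mono) simp
    finally show ?thesis
      using that \<epsilon> d by (simp add: ennreal_mult)
  qed
  txt \<open>Displacement interpolation towards \<open>C'\<close>: the weight is chosen such that exactly the
    budget \<open>\<epsilon>\<close> of the bound \<open>\<epsilon> + 2 * d\<close> remains.\<close>
  define \<theta> where "\<theta> = 2 * d / (\<epsilon> + 2 * d)"
  \<comment> \<open>\<open>d > 0\<close> keeps the denominator positive. For
    \<open>\<epsilon> = 0\<close> the weight is 1 and \<open>Q'\<close> becomes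
    \<open>empirical C'\<close> itself.\<close>
  have \<theta>: "0 \<le> \<theta>" "\<theta> \<le> 1" "\<theta> * (\<epsilon> + 2 * d) = 2 * d" "(1 - \<theta>) * (\<epsilon> + 2 * d) = \<epsilon>"
    using \<epsilon> d add_nonneg_pos[of \<epsilon> "2 * d"] by (auto simp: \<theta>_def field_simps)
  define w where "w = (\<lambda>z :: 'k \<times> (real ^ 'n). (1 - \<theta>) *\<^sub>R snd z + \<theta> *\<^sub>R C' $ fst z)"
  have [measurable]: "w \<in> borel_measurable \<rho>"
    unfolding w_def by measurable
  define Q' where "Q' = distr \<rho> borel w"
  have "AE c in distr \<rho> borel snd. c \<in> S"
    unfolding \<rho>(4) by (rule AE_dists_on[OF Q_dist])
  moreover have S_borel: "S \<in> sets borel"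
    using Q_dist by (simp add: dists_on_def)
  ultimately have "AE z in \<rho>. snd z \<in> S"
    by (simp add: AE_distr_iff)
  then have w_S: "AE z in \<rho>. w z \<in> S"
    by eventually_elim (use S C' \<theta> in \<open>auto simp: w_def intro!: convexD\<close>)
  have "prob_space Q'"
    unfolding Q'_def by (rule prob_space_distr) measurable
  moreover have "AE c in Q'. c \<in> S"
    unfolding Q'_def using w_S S_borel by (simp add: AE_distr_iff)
  moreover have "sets Q' = sets borel"
    by (simp add: Q'_def)
  ultimately have Q'_dist: "Q' \<in> dists_on S"
    using S_borel by (auto simp: dists_on_def intro: prob_space.emeasure_eq_1_AE)
  \<comment> \<open>One \<open>\<rho>\<close> carries both couplings: pairing \<open>C'\<close> with
    \<open>w\<close> retains the fraction \<open>1 - \<theta>\<close> of each displacement and costs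
    at most \<open>\<epsilon>\<close>, while pairing \<open>snd\<close> with \<open>w\<close> below
    covers the fraction \<open>\<theta>\<close> and costs at most \<open>2 * d\<close>.\<close>
  define \<pi>' where "\<pi>' = distr \<rho> (borel \<Otimes>\<^sub>M borel) (\<lambda>z. (C' $ fst z, w z))"
  have "distr \<pi>' borel fst = distr (distr \<rho> (count_space UNIV) fst) borel (($) C')"
    by (simp add: \<pi>'_def distr_distr comp_def)
  also have "\<dots> = empirical C'"
    by (simp add: \<rho>(3) empirical_def)
  finally have "\<pi>' \<in> couplings (empirical C') Q'"
    by (auto simp: couplings_def \<pi>'_def Q'_def distr_distr comp_def intro!: prob_space_distr)
  moreover have "(\<integral>\<^sup>+ (c, c'). ennreal (lp_norm p (c - c')) \<partial>\<pi>') \<le> ennreal \<epsilon>"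
  proof -
    have "C' $ fst z - w z = (1 - \<theta>) *\<^sub>R (C' $ fst z - snd z)" for z
      by (simp add: w_def algebra_simps)
    then have "(\<integral>\<^sup>+ (c, c'). ennreal (lp_norm p (c - c')) \<partial>\<pi>')
        = (\<integral>\<^sup>+ z. ennreal ((1 - \<theta>) * lp_norm p (C' $ fst z - snd z)) \<partial>\<rho>)"
      using \<theta> by (simp add: \<pi>'_def nn_integral_distr case_prod_unfold lp_norm_scaleR[OF p])
    also have "\<dots> \<le> ennreal \<epsilon>"
      using scaled[of "1 - \<theta>"] \<theta> by simp
    finally show ?thesis .
  qed
  ultimately have "Q' \<in> ambiguity_set p \<epsilon> S C'"
    using Q'_dist by (auto simp: ambiguity_set_def wasserstein1_def intro: INF_lower2)
  moreover have "distr \<rho> (borel \<Otimes>\<^sub>M borel) (\<lambda>z. (snd z, w z)) \<in> couplings Q Q'"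
    using \<rho>(4) by (auto simp: couplings_def Q'_def distr_distr comp_def intro!: prob_space_distr)
  moreover have "(\<integral>\<^sup>+ (c, c'). ennreal (lp_norm p (c' - c))
      \<partial>distr \<rho> (borel \<Otimes>\<^sub>M borel) (\<lambda>z. (snd z, w z))) \<le> ennreal (2 * d)"
  proof -
    have "w z - snd z = \<theta> *\<^sub>R (C' $ fst z - snd z)" for z
      by (simp add: w_def algebra_simps)
    then have "(\<integral>\<^sup>+ (c, c'). ennreal (lp_norm p (c' - c))
        \<partial>distr \<rho> (borel \<Otimes>\<^sub>M borel) (\<lambda>z. (snd z, w z)))
        = (\<integral>\<^sup>+ z. ennreal (\<theta> * lp_norm p (C' $ fst z - snd z)) \<partial>\<rho>)"
      using \<theta> by (simp add: nn_integral_distr case_prod_unfold lp_norm_scaleR[OF p])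
    also have "\<dots> \<le> ennreal (2 * d)"
      using scaled[of \<theta>] \<theta> by simp
    finally show ?thesis .
  qed
  ultimately show thesis
    by (rule that)
qed

text \<open>Each \<open>Q\<close> admissible for \<open>C\<close> has a nearby competitor admissible
  for \<open>C'\<close>, so the infimum for \<open>C'\<close> cannot be much larger. Samples move by
  at most \<open>CARD('n) * \<eta>\<close> in the ground norm, transport costs at most twice that,
  and returning to the Euclidean norm adds another \<open>CARD('n)\<close>.\<close>

lemma follower_objective_perturb:
  fixes C C' :: "(real ^ 'n) ^ 'k"
  assumes p: "p \<in> {1, \<infinity>}" and \<epsilon>: "\<epsilon> \<ge> 0" and \<alpha>: "\<alpha> \<in> {0<..<1}"
    and S: "convex S" and R: "\<And>c. c \<in> S \<Longrightarrow> norm c \<le> R"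
    and \<eta>: "\<eta> > 0" "norm (C' - C) \<le> \<eta>" and C': "\<And>k. C' $ k \<in> S"
  shows "follower_objective p S \<alpha> \<epsilon> C' y' \<le> follower_objective p S \<alpha> \<epsilon> C y
    + ereal ((2 * (real CARD('n))\<^sup>2 * \<eta> * norm y + R * norm (y' - y)) / (1 - \<alpha>))"
    (is "_ \<le> _ + ereal ?D")
proof -
  note [measurable] = measurable_lp_norm[OF p]
  define d where "d = real CARD('n) * \<eta>"
  have d: "d > 0" using \<eta> by (simp add: d_def)
  have close: "lp_norm p (C' $ k - C $ k) \<le> d" for k
  proof -
    have "lp_norm p (C' $ k - C $ k) \<le> real CARD('n) * norm (C' $ k - C $ k)"
      by (rule lp_norm_le_norm[OF p])
    also have "\<dots> \<le> d"
      using Finite_Cartesian_Product.norm_nth_le[of "C' - C" k] \<eta>(2) unfolding d_def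
      by (intro mult_left_mono) auto
    finally show ?thesis .
  qed
  \<comment> \<open>With the real number \<open>?D\<close> on the left, the bound is uniform in
    \<open>Q\<close> and passes to the infimum; subtracting a real can be undone afterwards.\<close>
  have "follower_objective p S \<alpha> \<epsilon> C' y' - ereal ?D \<le> ereal (rho_f \<alpha> y Q)"
    if Q: "Q \<in> ambiguity_set p \<epsilon> S C" for Q
  proof -
    obtain Q' \<pi> where Q': "Q' \<in> ambiguity_set p \<epsilon> S C'" and \<pi>: "\<pi> \<in> couplings Q Q'"
      and cost: "(\<integral>\<^sup>+ (c, c'). ennreal (lp_norm p (c' - c)) \<partial>\<pi>) \<le> ennreal (2 * d)"
      using ambiguity_set_perturb[OF p \<epsilon> S d close C' Q] by blast
    have \<pi>': "prob_space \<pi>" "sets \<pi> = sets (borel \<Otimes>\<^sub>M borel)"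
      "distr \<pi> borel fst = Q" "distr \<pi> borel snd = Q'"
      using \<pi> by (auto simp: couplings_def)
    note [measurable_cong] = \<pi>'(2)
    have dists: "Q \<in> dists_on S" "Q' \<in> dists_on S"
      using Q Q' by (auto simp: ambiguity_set_def)
    then have [measurable]: "S \<in> sets borel"
      by (simp add: dists_on_def)
    have supp: "AE z in \<pi>. fst z \<in> S" "AE z in \<pi>. snd z \<in> S"
      using dists[THEN AE_dists_on] unfolding \<pi>'(3,4)[symmetric] by (auto simp: AE_distr_iff)
    have "(\<integral>\<^sup>+ z. ennreal (norm (snd z - fst z)) \<partial>\<pi>)
        \<le> (\<integral>\<^sup>+ z. ennreal (real CARD('n)) * ennreal (lp_norm p (snd z - fst z)) \<partial>\<pi>)"
      by (intro nn_integral_mono)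
        (simp add: ennreal_mult[symmetric] lp_norm_nonneg[OF p] norm_le_lp_norm[OF p])
    also have "\<dots> \<le> ennreal (real CARD('n)) * ennreal (2 * d)"
      using cost by (subst nn_integral_cmult) (auto simp: case_prod_unfold intro!: mult_left_mono)
    also have "\<dots> = ennreal (2 * (real CARD('n))\<^sup>2 * \<eta>)"
      using \<eta>(1) by (simp add: ennreal_mult[symmetric] d_def power2_eq_square mult_ac)
    finally have "rho_f \<alpha> y' (distr \<pi> borel snd) \<le> rho_f \<alpha> y (distr \<pi> borel fst) + ?D"
      using \<eta>(1) by (intro rho_f_distr_perturb[OF \<pi>'(1) \<alpha> _ _ supp R]) auto
    then have rho: "ereal (rho_f \<alpha> y' Q') \<le> ereal (rho_f \<alpha> y Q) + ereal ?D"
      unfolding \<pi>'(3,4) by simp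
    have "follower_objective p S \<alpha> \<epsilon> C' y' \<le> ereal (rho_f \<alpha> y' Q')"
      unfolding follower_objective_def using Q' by (rule INF_lower)
    also note rho
    finally show ?thesis
      by (simp add: ereal_minus_le)
  qed
  then have "follower_objective p S \<alpha> \<epsilon> C' y' - ereal ?D \<le> follower_objective p S \<alpha> \<epsilon> C y"
    unfolding follower_objective_def[of _ _ _ _ C] by (rule INF_greatest)
  then show ?thesis
    by (simp add: ereal_minus_le)
qed

text \<open>Here the data are fixed, so each \<open>Q\<close> is compared with itself at transport
  cost 0. The sign in \<open>rho_l_eq_rho_f\<close> reverses the inequality, hence the estimate is
  applied from \<open>- y\<close> to \<open>- y'\<close>.\<close>

lemma leader_objective_perturb:
  fixes C :: "(real ^ 'n) ^ 'k"
  assumes \<alpha>: "\<alpha> \<in> {0<..<1}" and R: "\<And>c. c \<in> S \<Longrightarrow> norm c \<le> R"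
  shows "leader_objective p S \<alpha> \<epsilon> C y
    \<le> leader_objective p S \<alpha> \<epsilon> C y' + ereal (R * norm (y' - y) / (1 - \<alpha>))"
    (is "_ \<le> _ + ereal ?D")
  unfolding leader_objective_def[of _ _ _ _ _ y]
proof (rule SUP_least)
  fix Q assume Q: "Q \<in> ambiguity_set p \<epsilon> S C"
  then have dist: "Q \<in> dists_on S"
    by (auto simp: ambiguity_set_def)
  then have Q': "prob_space Q" "sets Q = sets borel"
    by (auto simp: dists_on_def)
  note [measurable_cong] = Q'(2)
  have "distr Q borel (\<lambda>c. c) = Q"
    using Q'(2) by (intro distr_id2) auto
  then have "rho_f \<alpha> (- y') Q \<le> rho_f \<alpha> (- y) Q + (0 * norm (- y) + R * norm (- y' - - y)) / (1 - \<alpha>)"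
    using rho_f_distr_perturb[OF Q'(1) \<alpha> _ _ AE_dists_on[OF dist] AE_dists_on[OF dist] R, of 0 "- y'" "- y"]
    by simp
  then have "ereal (rho_l \<alpha> y Q) \<le> ereal (rho_l \<alpha> y' Q) + ereal ?D"
    by (simp add: rho_l_eq_rho_f norm_minus_commute)
  also have "ereal (rho_l \<alpha> y' Q) \<le> leader_objective p S \<alpha> \<epsilon> C y'"
    unfolding leader_objective_def using Q by (rule SUP_upper)
  finally show "ereal (rho_l \<alpha> y Q) \<le> leader_objective p S \<alpha> \<epsilon> C y' + ereal ?D"
    by (simp add: add_right_mono)
qed

section \<open>Lower semicontinuity of the optimistic value\<close>

text \<open>This is the closed-graph property of the follower's best responses. For a rival
  \<open>z\<close>, pass from \<open>C\<close> to \<open>Cs n\<close>, use optimality of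
  \<open>ys n\<close> there, and return from \<open>Cs n\<close>, \<open>ys n\<close> to
  \<open>C\<close>, \<open>y\<close>; both passages cost a vanishing error.\<close>

lemma follower_argmax_limit:
  fixes C :: "(real ^ 'n) ^ 'k"
  assumes p: "p \<in> {1, \<infinity>}" and \<epsilon>: "\<epsilon> \<ge> 0" and \<alpha>: "\<alpha> \<in> {0<..<1}"
    and S: "convex S" "bounded S" and A: "closed A"
    and C: "Cs \<longlonglongrightarrow> C" "\<And>n k. Cs n $ k \<in> S" "\<And>k. C $ k \<in> S"
    and ys: "ys \<longlonglongrightarrow> y" "\<And>n. ys n \<in> follower_argmax p S \<alpha> \<epsilon> (Cs n) A"
  shows "y \<in> follower_argmax p S \<alpha> \<epsilon> C A"
proof -
  let ?f = "follower_objective p S \<alpha> \<epsilon>"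
  obtain R where R: "\<And>c. c \<in> S \<Longrightarrow> norm c \<le> R"
    using S(2) by (auto simp: bounded_iff)
  \<comment> \<open>The extra \<open>1 / real (Suc n)\<close> gives the strict positivity that the
    perturbation bound demands even if \<open>Cs n = C\<close>.\<close>
  define \<eta> where "\<eta> = (\<lambda>n. norm (Cs n - C) + 1 / real (Suc n))"
  have \<eta>: "\<eta> n > 0" "norm (Cs n - C) \<le> \<eta> n" "norm (C - Cs n) \<le> \<eta> n" for n
    by (auto simp: \<eta>_def norm_minus_commute add_nonneg_pos)
  have \<eta>_lim: "\<eta> \<longlonglongrightarrow> 0"
    unfolding \<eta>_def using LIMSEQ_inverse_real_of_nat
    by (intro tendsto_add_zero tendsto_norm_zero) (use C(1) in \<open>simp_all add: LIM_zero inverse_eq_divide\<close>)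
  have mem: "ys n \<in> A" and opt: "z \<in> A \<Longrightarrow> ?f (Cs n) z \<le> ?f (Cs n) (ys n)" for n z
    using ys(2)[of n] by (auto simp: follower_argmax_def is_arg_max_def not_less)
  have "?f C z \<le> ?f C y" if z: "z \<in> A" for z
  proof -
    \<comment> \<open>The factors of \<open>\<eta> n\<close> involve only the fixed vectors
      \<open>y\<close> and \<open>z\<close>. The vanishing term \<open>norm (z - z)\<close> keeps
      the shape of the perturbation bound.\<close>
    define s where "s = (\<lambda>n. (2 * (real CARD('n))\<^sup>2 * \<eta> n * norm y + R * norm (ys n - y)) / (1 - \<alpha>)
      + (2 * (real CARD('n))\<^sup>2 * \<eta> n * norm z + R * norm (z - z)) / (1 - \<alpha>))"
    have "s \<longlonglongrightarrow> 0"
      unfolding s_def using \<alpha> by (auto intro!: tendsto_eq_intros \<eta>_lim ys(1))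
    have le: "?f C z \<le> ?f C y + ereal (s n)" for n
    proof -
      have "?f C z \<le> ?f (Cs n) z
          + ereal ((2 * (real CARD('n))\<^sup>2 * \<eta> n * norm z + R * norm (z - z)) / (1 - \<alpha>))"
        by (rule follower_objective_perturb[OF p \<epsilon> \<alpha> S(1) R \<eta>(1,3) C(3)])
      also have "\<dots> \<le> ?f (Cs n) (ys n)
          + ereal ((2 * (real CARD('n))\<^sup>2 * \<eta> n * norm z + R * norm (z - z)) / (1 - \<alpha>))"
        by (intro add_right_mono opt z)
      also have "\<dots> \<le> (?f C y
          + ereal ((2 * (real CARD('n))\<^sup>2 * \<eta> n * norm y + R * norm (ys n - y)) / (1 - \<alpha>)))
          + ereal ((2 * (real CARD('n))\<^sup>2 * \<eta> n * norm z + R * norm (z - z)) / (1 - \<alpha>))"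
        by (intro add_right_mono follower_objective_perturb[OF p \<epsilon> \<alpha> S(1) R \<eta>(1,2) C(2)])
      also have "\<dots> = ?f C y + ereal (s n)"
        unfolding s_def plus_ereal.simps(1)[symmetric] add.assoc ..
      finally show ?thesis .
    qed
    show ?thesis
    proof (rule ereal_le_epsilon2)
      fix e :: real assume "e > 0"
      then have "\<forall>\<^sub>F n in sequentially. s n < e"
        using \<open>s \<longlonglongrightarrow> 0\<close> by (rule order_tendstoD(2)[rotated])
      then obtain n where "s n < e"
        by (auto simp: eventually_sequentially)
      then have "?f C y + ereal (s n) \<le> ?f C y + ereal e"
        by (intro add_left_mono) simp
      with le[of n] show "?f C z \<le> ?f C y + ereal e"
        by (rule order_trans)
    qed
  qed
  moreover have "y \<in> A"
    using closed_sequentially[OF A mem ys(1)] .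
  ultimately show ?thesis
    by (auto simp: follower_argmax_def is_arg_max_def not_less)
qed

text \<open>The value \<open>V x C\<close> of the overview, with \<open>A\<close> standing for
  \<open>Y x\<close>; it is infinite if the argmax is empty.\<close>

definition optimistic_value ::
  "ereal \<Rightarrow> (real ^ 'n) set \<Rightarrow> real \<Rightarrow> real \<Rightarrow> (real ^ 'n) ^ 'kl \<Rightarrow> real \<Rightarrow> real \<Rightarrow>
   (real ^ 'n) set \<Rightarrow> (real ^ 'n) ^ 'kf \<Rightarrow> ereal" where
  "optimistic_value p S \<alpha>\<^sub>l \<epsilon>\<^sub>l C\<^sub>l \<alpha>\<^sub>f \<epsilon>\<^sub>f A C =
     (INF y\<in>follower_argmax p S \<alpha>\<^sub>f \<epsilon>\<^sub>f C A. leader_objective p S \<alpha>\<^sub>l \<epsilon>\<^sub>l C\<^sub>l y)"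

lemma basic_value_eq:
  "basic_value X Y p S \<alpha>\<^sub>l \<epsilon>\<^sub>l C\<^sub>l \<alpha>\<^sub>f \<epsilon>\<^sub>f C
     = (INF x\<in>X. optimistic_value p S \<alpha>\<^sub>l \<epsilon>\<^sub>l C\<^sub>l \<alpha>\<^sub>f \<epsilon>\<^sub>f (Y x) C)"
  unfolding basic_value_def optimistic_value_def
  by (intro antisym INF_greatest) (auto intro: INF_lower INF_lower2)

lemma semi_pessimistic_value_eq:
  "semi_pessimistic_value X Y p S \<alpha>\<^sub>l \<epsilon>\<^sub>l C\<^sub>l \<alpha>\<^sub>f \<epsilon>\<^sub>f U
     = (INF x\<in>X. SUP C\<in>U. optimistic_value p S \<alpha>\<^sub>l \<epsilon>\<^sub>l C\<^sub>l \<alpha>\<^sub>f \<epsilon>\<^sub>f (Y x) C)"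
  by (simp add: semi_pessimistic_value_def optimistic_value_def)

text \<open>Otherwise data sets \<open>Cs n\<close> tending to \<open>C\<close> have best responses
  that undercut \<open>V C\<close> by more than \<open>\<delta>\<close>. By compactness of
  \<open>A\<close> these accumulate at some \<open>y\<close>, a best response to \<open>C\<close>,
  and continuity of the leader's objective contradicts the gap.\<close>

lemma optimistic_value_lower_semicontinuous:
  fixes C :: "(real ^ 'n) ^ 'k" and C\<^sub>l :: "(real ^ 'n) ^ 'l"
  assumes p: "p \<in> {1, \<infinity>}" and \<epsilon>: "\<epsilon>\<^sub>f \<ge> 0" and \<alpha>: "\<alpha>\<^sub>f \<in> {0<..<1}" "\<alpha>\<^sub>l \<in> {0<..<1}"
    and S: "convex S" "bounded S" and A: "compact A" and C: "\<And>k. C $ k \<in> S" and \<delta>: "\<delta> > 0"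
  shows "\<forall>\<^sub>F C' in nhds C. (\<forall>k. C' $ k \<in> S) \<longrightarrow>
    optimistic_value p S \<alpha>\<^sub>l \<epsilon>\<^sub>l C\<^sub>l \<alpha>\<^sub>f \<epsilon>\<^sub>f A C - ereal \<delta>
      \<le> optimistic_value p S \<alpha>\<^sub>l \<epsilon>\<^sub>l C\<^sub>l \<alpha>\<^sub>f \<epsilon>\<^sub>f A C'"
proof (rule ccontr)
  define V :: "(real ^ 'n) ^ 'k \<Rightarrow> ereal" where "V = optimistic_value p S \<alpha>\<^sub>l \<epsilon>\<^sub>l C\<^sub>l \<alpha>\<^sub>f \<epsilon>\<^sub>f A"
  let ?L = "leader_objective p S \<alpha>\<^sub>l \<epsilon>\<^sub>l C\<^sub>l"
  let ?M = "follower_argmax p S \<alpha>\<^sub>f \<epsilon>\<^sub>f"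
  obtain R where R: "\<And>c. c \<in> S \<Longrightarrow> norm c \<le> R"
    using S(2) by (auto simp: bounded_iff)
  assume "\<not> ?thesis"
  then have "\<exists>C'. dist C' C < 1 / real (Suc n) \<and> (\<forall>k. C' $ k \<in> S) \<and> V C' < V C - ereal \<delta>" for n
    unfolding eventually_nhds_metric V_def[symmetric] by (force simp: not_le)
  \<comment> \<open>The strict inequality yields an actual best response below the threshold, so the
    infimum need not be attained.\<close>
  then have "\<exists>C' y. dist C' C < 1 / real (Suc n) \<and> (\<forall>k. C' $ k \<in> S) \<and> y \<in> ?M C' A
      \<and> ?L y < V C - ereal \<delta>" for n
    unfolding V_def optimistic_value_def INF_less_iff by blast
  then obtain Cs ys where Cs: "\<And>n. dist (Cs n) C < 1 / real (Suc n)" "\<And>n k. Cs n $ k \<in> S"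
    and ys: "\<And>n. ys n \<in> ?M (Cs n) A" "\<And>n. ?L (ys n) < V C - ereal \<delta>"
    by metis
  have "Cs \<longlonglongrightarrow> C"
  proof (rule metric_tendsto_imp_tendsto[OF LIMSEQ_inverse_real_of_nat])
    show "\<forall>\<^sub>F n in sequentially. dist (Cs n) C \<le> dist (inverse (real (Suc n))) 0"
      using Cs(1) by (intro always_eventually allI) (simp add: less_imp_le inverse_eq_divide)
  qed
  have "\<And>n. ys n \<in> A"
    using ys(1) by (auto simp: follower_argmax_def is_arg_max_def)
  with A obtain y r where r: "strict_mono (r :: nat \<Rightarrow> nat)" and lim: "(ys \<circ> r) \<longlonglongrightarrow> y"
    unfolding compact_def by metis
  have "y \<in> ?M C A"
    by (rule follower_argmax_limit[OF p \<epsilon> \<alpha>(1) S compact_imp_closed[OF A]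
          LIMSEQ_subseq_LIMSEQ[OF \<open>Cs \<longlonglongrightarrow> C\<close> r] _ C lim]) (use Cs ys in auto)
  then have V_le: "V C \<le> ?L y"
    unfolding V_def optimistic_value_def by (rule INF_lower)
  have "(\<lambda>n. R * norm ((ys \<circ> r) n - y) / (1 - \<alpha>\<^sub>l)) \<longlonglongrightarrow> 0"
    using \<alpha> by (auto intro!: tendsto_eq_intros lim[unfolded comp_def])
  then have "\<forall>\<^sub>F n in sequentially. R * norm ((ys \<circ> r) n - y) / (1 - \<alpha>\<^sub>l) < \<delta>"
    using \<delta> by (rule order_tendstoD(2))
  then obtain n where n: "R * norm (ys (r n) - y) / (1 - \<alpha>\<^sub>l) < \<delta>"
    by (auto simp: eventually_sequentially)
  note V_le
  also have "?L y \<le> ?L (ys (r n)) + ereal (R * norm (ys (r n) - y) / (1 - \<alpha>\<^sub>l))"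
    by (rule leader_objective_perturb[OF \<alpha>(2) R])
  also have "\<dots> \<le> ?L (ys (r n)) + ereal \<delta>"
    using n by (intro add_left_mono) simp
  finally have "V C - ereal \<delta> \<le> ?L (ys (r n))"
    by (simp add: ereal_minus_le)
  with ys(2)[of "r n"] show False by simp
qed

section \<open>Scenarios near the true data set, and the conclusion\<close>

text \<open>If \<open>q < 1\<close> is the mass of the complement of \<open>G\<close>, independence
  bounds the probability of never hitting \<open>G\<close> by \<open>q ^ Suc n\<close> for every
  \<open>n\<close>. Indices start at 1 to match the scenario numbering
  \<open>{1..r}\<close>.\<close>

lemma AE_iid_samples_ex_mem:
  fixes \<xi> :: "nat \<Rightarrow> 'w \<Rightarrow> 'a::topological_space"
  assumes iid: "iid_samples M P \<xi>" and G: "G \<in> sets borel" "emeasure P G > 0"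
  shows "AE \<omega> in M. \<exists>i\<ge>1. \<xi> i \<omega> \<in> G"
proof -
  interpret prob_space M using iid by (simp add: iid_samples_def)
  have indep: "indep_vars (\<lambda>_. borel) \<xi> UNIV" and P: "\<And>i. distr M borel (\<xi> i) = P"
    using iid by (auto simp: iid_samples_def)
  have [measurable]: "\<And>i. \<xi> i \<in> borel_measurable M"
    using indep by (simp add: indep_vars_def)
  note [measurable] = G(1)
  define q where "q = measure P (- G)"
  have q: "prob (\<xi> i -` (- G) \<inter> space M) = q" for i
    unfolding q_def P[of i, symmetric] using G(1) by (subst measure_distr) auto
  have "prob (\<xi> 0 -` G \<inter> space M) = measure P G"
    unfolding P[of 0, symmetric] by (subst measure_distr) auto
  moreover have "measure P G > 0"
  proof -
    interpret P: prob_space P unfolding P[of 0, symmetric] by (rule prob_space_distr) simp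
    show ?thesis using G(2) by (simp add: P.emeasure_eq_measure)
  qed
  moreover have "prob (\<xi> 0 -` (- G) \<inter> space M) = 1 - prob (\<xi> 0 -` G \<inter> space M)"
    by (subst prob_compl[symmetric]) (auto intro!: arg_cong[where f = prob])
  ultimately have "q < 1"
    using q[of 0] by simp
  have "q \<ge> 0"
    by (simp add: q_def)
  define B where "B = {\<omega> \<in> space M. \<forall>i\<ge>1. \<xi> i \<omega> \<notin> G}"
  have [measurable]: "B \<in> sets M"
    unfolding B_def by measurable
  \<comment> \<open>\<open>Suc n\<close> keeps the index set \<open>{1..Suc n}\<close> non-empty, so
    that the intersection is an event of \<open>M\<close>.\<close>
  have "prob B \<le> q ^ Suc n" for n
  proof -
    have "prob B \<le> prob (\<Inter>i\<in>{1..Suc n}. \<xi> i -` (- G) \<inter> space M)"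
      using G(1) by (intro finite_measure_mono) (auto simp: B_def)
    also have "\<dots> = (\<Prod>i\<in>{1..Suc n}. prob (\<xi> i -` (- G) \<inter> space M))"
      using G(1) by (intro indep_varsD[OF indep]) auto
    also have "\<dots> = q ^ Suc n"
      unfolding q by simp
    finally show ?thesis .
  qed
  moreover have "(\<lambda>n. q ^ Suc n) \<longlonglongrightarrow> 0"
    using \<open>q < 1\<close> \<open>q \<ge> 0\<close> by (intro LIMSEQ_Suc LIMSEQ_realpow_zero)
  ultimately have "prob B \<le> 0"
    by (intro LIMSEQ_le_const) auto
  then have "emeasure M B = 0"
    by (simp add: emeasure_eq_measure measure_nonneg antisym)
  then show ?thesis
    by (intro AE_I[of _ _ B]) (auto simp: B_def)
qed

theorem theorem7:
  fixes H :: "real ^ 'm ^ 'q" and h :: "real ^ 'q"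
    and F :: "real ^ 'n ^ 'r" and L :: "real ^ 'm ^ 'r" and f :: "real ^ 'r"
    and B :: "real ^ 'n ^ 's" and b :: "real ^ 's"
    and X :: "(real ^ 'm) set" and Y :: "real ^ 'm \<Rightarrow> (real ^ 'n) set" and S :: "(real ^ 'n) set"
    and p :: ereal and \<alpha>\<^sub>l \<alpha>\<^sub>f \<epsilon>\<^sub>l \<epsilon>\<^sub>f \<delta> :: real
    and Qstar :: "(real ^ 'n) measure"
    and N :: "'v measure" and \<xi>\<^sub>l :: "'kl::finite \<Rightarrow> 'v \<Rightarrow> real ^ 'n"
    and \<xi>\<^sub>f :: "'kf::finite \<Rightarrow> 'v \<Rightarrow> real ^ 'n" and v :: 'v
    and C\<^sub>l :: "(real ^ 'n) ^ 'kl" and C\<^sub>f_star :: "(real ^ 'n) ^ 'kf"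
    and known :: "'kf \<Rightarrow> 'kl option" and lo hi :: "(real ^ 'n) ^ 'kf"
    and S\<^sub>l :: "((real ^ 'n) ^ 'kf) set" and P :: "((real ^ 'n) ^ 'kf) measure"
    and M :: "'w measure" and \<xi> :: "nat \<Rightarrow> 'w \<Rightarrow> (real ^ 'n) ^ 'kf"
  assumes X_def: "X = {x. (\<forall>i. x $ i \<in> {0, 1}) \<and> H *v x \<le> h}"
    and Y_def: "\<And>x. Y x = {y. 0 \<le> y \<and> F *v y + L *v x \<le> f}"
    and S_def: "S = {c. B *v c \<le> b}"
    and X: "X \<noteq> {}" "bounded X"
    and Y: "\<And>x. x \<in> X \<Longrightarrow> Y x \<noteq> {} \<and> bounded (Y x)"
    and S: "S \<noteq> {}" "compact S"
    and p: "p \<in> {1, \<infinity>}"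
    and alpha: "\<alpha>\<^sub>l \<in> {0<..<1}" "\<alpha>\<^sub>f \<in> {0<..<1}"
    and eps: "\<epsilon>\<^sub>l \<ge> 0" "\<epsilon>\<^sub>f \<ge> 0"
    and Qstar: "Qstar \<in> dists_on S"
    and data: "iid_samples N Qstar \<xi>\<^sub>l" "iid_samples N Qstar \<xi>\<^sub>f" "v \<in> space N"
    and C\<^sub>l: "C\<^sub>l = (\<chi> k. \<xi>\<^sub>l k v)" "\<And>k. C\<^sub>l $ k \<in> S"
    and C\<^sub>f_star: "C\<^sub>f_star = (\<chi> k. \<xi>\<^sub>f k v)"
    and boxes: "\<And>k. known k = None \<Longrightarrow> {lo $ k .. hi $ k} \<subseteq> S"
    and S\<^sub>l_def: "S\<^sub>l = data_uncertainty_set known lo hi C\<^sub>l"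
    and information: "C\<^sub>f_star \<in> S\<^sub>l"
    and P: "P \<in> dists_on S\<^sub>l" "supp_measure P = S\<^sub>l"
    and scenarios: "iid_samples M P \<xi>"
    and delta: "\<delta> > 0"
  shows "AE \<omega> in M. \<forall>\<^sub>F r in sequentially.
           semi_pessimistic_value X Y p S \<alpha>\<^sub>l \<epsilon>\<^sub>l C\<^sub>l \<alpha>\<^sub>f \<epsilon>\<^sub>f {\<xi> i \<omega> | i. i \<in> {1..r}}
             \<ge> basic_value X Y p S \<alpha>\<^sub>l \<epsilon>\<^sub>l C\<^sub>l \<alpha>\<^sub>f \<epsilon>\<^sub>f C\<^sub>f_star - ereal \<delta>"
proof -
  let ?V = "\<lambda>x. optimistic_value p S \<alpha>\<^sub>l \<epsilon>\<^sub>l C\<^sub>l \<alpha>\<^sub>f \<epsilon>\<^sub>f (Y x)"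
  have convex: "convex S"
    unfolding S_def convex_def
    by (auto simp: less_eq_vec_def matrix_vector_right_distrib matrix_vector_mult_scaleR
        intro!: convex_bound_le)
  have compact: "compact (Y x)" if "x \<in> X" for x
  proof -
    have "Y x = {0..} \<inter> (\<lambda>y. F *v y) -` {..f - L *v x}"
      by (auto simp: Y_def algebra_simps)
    moreover have "closed \<dots>"
      by (intro closed_Int closed_vimage continuous_intros) auto
    ultimately show ?thesis
      using Y[OF that] by (simp add: compact_eq_bounded_closed)
  qed
  have S_comp: "C $ k \<in> S" if "C \<in> S\<^sub>l" for C k
    using that boxes[of k] C\<^sub>l(2) by (force simp: S\<^sub>l_def data_uncertainty_set_def split: option.splits)
  have "finite X"
  proof (rule finite_subset)
    show "X \<subseteq> vec_lambda ` (UNIV \<rightarrow>\<^sub>E {0, 1})"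
    proof
      fix x assume "x \<in> X"
      then have "x = vec_lambda (vec_nth x)" "vec_nth x \<in> UNIV \<rightarrow>\<^sub>E {0, 1}"
        by (auto simp: X_def vec_nth_inverse)
      then show "x \<in> vec_lambda ` (UNIV \<rightarrow>\<^sub>E {0, 1})" by (rule image_eqI)
    qed
  qed (intro finite_imageI finite_PiE, auto)
  \<comment> \<open>Finiteness of \<open>X\<close> lets one neighbourhood serve all \<open>x\<close>
    at once.\<close>
  then have "\<forall>\<^sub>F C in nhds C\<^sub>f_star. \<forall>x\<in>X. (\<forall>k. C $ k \<in> S) \<longrightarrow> ?V x C\<^sub>f_star - ereal \<delta> \<le> ?V x C"
    using optimistic_value_lower_semicontinuous[OF p eps(2) alpha(2,1) convex
        compact_imp_bounded[OF S(2)] compact S_comp[OF information] delta]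
    by (intro eventually_ball_finite) auto
  then obtain G where G: "open G" "C\<^sub>f_star \<in> G"
    and V: "\<And>C x. C \<in> G \<Longrightarrow> x \<in> X \<Longrightarrow> (\<forall>k. C $ k \<in> S) \<Longrightarrow> ?V x C\<^sub>f_star - ereal \<delta> \<le> ?V x C"
    unfolding eventually_nhds by blast
  have "emeasure P G > 0"
    using G P(2) information by (auto simp: supp_measure_def)
  then have hit: "AE \<omega> in M. \<exists>i\<ge>1. \<xi> i \<omega> \<in> G"
    using G by (intro AE_iid_samples_ex_mem[OF scenarios]) auto
  \<comment> \<open>The bound on \<open>G\<close> covers only data sets with all samples in
    \<open>S\<close>; each scenario satisfies this outside a null set, and there are countably many
    scenarios.\<close>
  have "AE \<omega> in M. \<xi> i \<omega> \<in> S\<^sub>l" for i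
  proof -
    have distr: "distr M borel (\<xi> i) = P" and [measurable]: "\<xi> i \<in> borel_measurable M"
      using scenarios by (auto simp: iid_samples_def prob_space.indep_vars_def)
    have "S\<^sub>l \<in> sets borel" using P(1) by (simp add: dists_on_def)
    then show ?thesis
      using AE_dists_on[OF P(1)] unfolding distr[symmetric] by (subst (asm) AE_distr_iff) auto
  qed
  then have "AE \<omega> in M. \<forall>i. \<xi> i \<omega> \<in> S\<^sub>l"
    by (simp add: AE_all_countable)
  with hit show ?thesis
  proof eventually_elim
    case (elim \<omega>)
    then obtain i where i: "i \<ge> 1" "\<xi> i \<omega> \<in> G" and S\<^sub>l: "\<xi> i \<omega> \<in> S\<^sub>l" by blast
    \<comment> \<open>The threshold for \<open>r\<close> is the index \<open>i\<close> of a scenario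
      that hits \<open>G\<close>, which depends on \<open>\<omega>\<close>. That scenario belongs to
      every larger scenario set and bounds the supremum from below for all \<open>x\<close>
      simultaneously.\<close>
    show ?case
    proof (rule eventually_sequentiallyI)
      fix r assume "i \<le> r"
      let ?U = "{\<xi> i \<omega> | i. i \<in> {1..r}}"
      have "basic_value X Y p S \<alpha>\<^sub>l \<epsilon>\<^sub>l C\<^sub>l \<alpha>\<^sub>f \<epsilon>\<^sub>f C\<^sub>f_star - ereal \<delta> \<le> (SUP C\<in>?U. ?V x C)"
        if x: "x \<in> X" for x
      proof -
        have "basic_value X Y p S \<alpha>\<^sub>l \<epsilon>\<^sub>l C\<^sub>l \<alpha>\<^sub>f \<epsilon>\<^sub>f C\<^sub>f_star - ereal \<delta> \<le> ?V x C\<^sub>f_star - ereal \<delta>"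
          unfolding basic_value_eq using x by (intro ereal_minus_mono INF_lower) auto
        also have "\<dots> \<le> ?V x (\<xi> i \<omega>)"
          using V[OF i(2) x] S_comp[OF S\<^sub>l] by blast
        also have "\<dots> \<le> (SUP C\<in>?U. ?V x C)"
          using i(1) \<open>i \<le> r\<close> by (intro SUP_upper) auto
        finally show ?thesis .
      qed
      then show "semi_pessimistic_value X Y p S \<alpha>\<^sub>l \<epsilon>\<^sub>l C\<^sub>l \<alpha>\<^sub>f \<epsilon>\<^sub>f ?U
          \<ge> basic_value X Y p S \<alpha>\<^sub>l \<epsilon>\<^sub>l C\<^sub>l \<alpha>\<^sub>f \<epsilon>\<^sub>f C\<^sub>f_star - ereal \<delta>"
        unfolding semi_pessimistic_value_eq by (rule INF_greatest)
    qed
  qed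
qed

end
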